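(* Let $\alpha\ge0$ and $\beta>-1$ be real numbers, let $m,m'\in\{0,1,2,\ldots\}$, and put $\nu:=m-m'$. Then, as $r\to+\infty$, $$\sum_{l=1}^{\infty}J_{l+m'}(r)J_{l+m}(r)(l+\beta)^\alpha=\frac{2^{-\alpha-1}\,\Gamma(\alpha+1)}{\Gamma\left(\frac{-\nu+\alpha+2}{2}\right)\Gamma\left(\frac{\nu+\alpha+2}{2}\right)}\,r^\alpha+o(r^\alpha),$$ where the coefficient is understood as its continuous extension for those values of $\alpha$ where it is undefined (i.e. $1/\Gamma$ is taken to be $0$ at the poles of $\Gamma$).
   Context: $J_n$ denotes the Bessel function of the first kind of order $n$. *)

theory Defs
  imports "HOL-Analysis.Gamma_Function" "HOL-Library.Landau_Symbols"
begin

definition Bessel_J :: "nat \<Rightarrow> real \<Rightarrow> real" where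
  "Bessel_J n x = (\<Sum>k. (-1) ^ k / (fact k * fact (n + k)) * (x / 2) ^ (2 * k + n))"

end

theory Submission
  imports Defs "HOL-Analysis.Analysis"
begin

text \<open>Extend \<open>J\<^sub>n\<close> to integer orders by \<open>J\<^sub>-\<^sub>n = (-1)\<^sup>n J\<^sub>n\<close>, put \<open>\<nu> = m - m'\<close>, and consider the signed measures on
  the real line with mass \<open>J\<^sub>n(r) J\<^sub>n\<^sub>+\<^sub>\<nu>(r)\<close> at \<open>(n + c) / r\<close>, where \<open>c\<close> is any constant shift. Neumann's
  identity gives their total mass \<open>\<delta>\<^sub>\<nu>\<^sub>0\<close>, and the recurrence \<open>(n / r) J\<^sub>n = (J\<^sub>n\<^sub>-\<^sub>1 + J\<^sub>n\<^sub>+\<^sub>1) / 2\<close> shows by induction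
  that all moments converge to those of the image of \<open>cos (\<nu> u) du / \<pi>\<close> on \<open>[0, \<pi>]\<close> under \<open>cos\<close>, as
  \<open>cos u cos (\<nu> u) = (cos ((\<nu> - 1) u) + cos ((\<nu> + 1) u)) / 2\<close> is the same recurrence. Polynomial
  approximation with a polynomial error bound, small in mean for \<open>\<nu> = 0\<close>, extends the convergence to
  the function \<open>x\<^sup>\<alpha>\<close> on \<open>x > 0\<close>, continued by \<open>0\<close>. With \<open>c = \<beta> - m'\<close> this is the sum in question divided by
  \<open>r\<^sup>\<alpha>\<close>. The limit integral is a Beta function for \<open>\<nu> = 0\<close>, and the recurrence in \<open>\<nu>\<close> yields the rest.\<close>

subsection \<open>Bessel functions of integer order\<close>

lemma has_sum_mult_Times:
  fixes f :: "'a \<Rightarrow> real" and g :: "'b \<Rightarrow> real"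
  assumes f: "(f has_sum s) A" and g: "(g has_sum t) B"
  shows "((\<lambda>(x, y). f x * g y) has_sum s * t) (A \<times> B)"
proof (rule has_sum_SigmaI)
  show "((\<lambda>y. case (x, y) of (x, y) \<Rightarrow> f x * g y) has_sum f x * t) B" for x
    using has_sum_cmult_right[OF g, of "f x"] by simp
  show "((\<lambda>x. f x * t) has_sum s * t) A"
    using has_sum_cmult_left[OF f] .
  have fa: "(\<lambda>x. \<bar>f x\<bar>) summable_on A" and ga: "(\<lambda>y. \<bar>g y\<bar>) summable_on B"
    using assms[THEN has_sum_imp_summable] summable_on_iff_abs_summable_on_real by fastforce+
  have "(\<lambda>p. norm (case p of (x, y) \<Rightarrow> f x * g y)) summable_on A \<times> B"
    unfolding Infinite_Sum.abs_summable_on_Sigma_iff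
    by (auto simp: abs_mult infsum_cmult_right' abs_of_nonneg infsum_nonneg
        intro!: summable_on_cmult_right summable_on_cmult_left fa ga)
  then show "(\<lambda>(x, y). f x * g y) summable_on A \<times> B"
    using summable_on_iff_abs_summable_on_real by blast
qed

text \<open>Each \<open>F n * F (n + \<nu>)\<close> is the sum of \<open>f p * f q\<close> over a
  product of two fibres of \<open>g\<close>, and as n varies these products partition the pairs with
  \<open>g q = g p + \<nu>\<close>. It is applied once with differences and once with sums of
  indices.\<close>

lemma has_sum_correlation:
  fixes f :: "'a \<Rightarrow> real" and g :: "'a \<Rightarrow> int" and \<nu> :: int
  assumes f: "f summable_on UNIV"
  defines "F \<equiv> \<lambda>n. infsum f {p. g p = n}"
  shows "((\<lambda>n. F n * F (n + \<nu>)) has_sum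
           (\<Sum>\<^sub>\<infinity>(p, q) | g q = g p + \<nu>. f p * f q)) UNIV"
proof (rule has_sum_SigmaD)
  let ?D = "{(p, q). g q = g p + \<nu>}" and ?A = "\<lambda>n. {p. g p = n}"
  have "(\<lambda>(p, q). f p * f q) summable_on UNIV \<times> UNIV"
    using has_sum_mult_Times[OF has_sum_infsum[OF f] has_sum_infsum[OF f]]
    by (rule has_sum_imp_summable)
  then have D: "(\<lambda>(p, q). f p * f q) summable_on ?D"
    by (rule summable_on_subset) auto
  show "((\<lambda>(n, p, q). f p * f q) has_sum (\<Sum>\<^sub>\<infinity>(p, q) | g q = g p + \<nu>. f p * f q))
          (Sigma UNIV (\<lambda>n. ?A n \<times> ?A (n + \<nu>)))"
    by (rule has_sum_reindex_bij_witness[where i = "\<lambda>(p, q). (g p, p, q)" and j = snd, THEN iffD2,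
          OF _ _ _ _ _ refl has_sum_infsum[OF D]]) auto
  show "((\<lambda>y. case (n, y) of (n, p, q) \<Rightarrow> f p * f q) has_sum F n * F (n + \<nu>))
          (?A n \<times> ?A (n + \<nu>))" for n
    using has_sum_mult_Times[OF has_sum_infsum has_sum_infsum, of f "?A n" f "?A (n + \<nu>)"]
      summable_on_subset[OF f] by (simp add: F_def)
qed

text \<open>With y = x / 2 these are the coefficients of exp(-y/t) exp(y t) = exp((x/2)(t - 1/t)),
  the generating function of the Bessel functions; the pair (k, j) contributes to the power
  t^(j-k).\<close>

definition bessel_coeff :: "real \<Rightarrow> nat \<times> nat \<Rightarrow> real" where
  "bessel_coeff y = (\<lambda>(k, j). ((- y) ^ k / fact k) * (y ^ j / fact j))"

lemma summable_on_bessel_coeff: "bessel_coeff y summable_on UNIV"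
proof -
  have "((\<lambda>k. x ^ k / fact k) has_sum exp x) UNIV" for x :: real
  proof (rule norm_summable_imp_has_sum)
    show "(\<lambda>k. x ^ k / fact k) sums exp x"
      using exp_converges[of x] by (simp add: divide_inverse mult.commute)
    show "summable (\<lambda>k. norm (x ^ k / fact k))"
      using summable_norm_exp[of x] by (simp add: divide_inverse mult.commute)
  qed
  from has_sum_mult_Times[OF this this, of "- y" y] show ?thesis
    unfolding bessel_coeff_def by (auto dest: has_sum_imp_summable)
qed

text \<open>This sign convention makes \<open>bessel_Z n x\<close> the coefficient of t^n in
  exp((x/2)(t - 1/t)) for every integer n.\<close>

definition bessel_Z :: "int \<Rightarrow> real \<Rightarrow> real" where
  "bessel_Z n x = (if n \<ge> 0 then Bessel_J (nat n) x else (-1) ^ nat (- n) * Bessel_J (nat (- n)) x)"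

text \<open>Parametrizing the two diagonals by (k, k + n) and (k + n, k) gives the Bessel series, in
  the second case with the extra sign from \<open>(- y) ^ (k + n)\<close>. Convergence of the series
  is inherited from the double family, so the three facts are proved together.\<close>

lemma Bessel_J_sums:
  "(\<lambda>k. (-1) ^ k / (fact k * fact (n + k)) * (x / 2) ^ (2 * k + n)) sums Bessel_J n x"
  and infsum_bessel_coeff_diff_nonneg:
  "infsum (bessel_coeff (x / 2)) {(k, j). int j - int k = int n} = Bessel_J n x"
  and infsum_bessel_coeff_diff_nonpos:
  "infsum (bessel_coeff (x / 2)) {(k, j). int j - int k = - int n} = (-1) ^ n * Bessel_J n x"
proof -
  let ?t = "\<lambda>k. (-1) ^ k / (fact k * fact (n + k)) * (x / 2) ^ (2 * k + n)"
  have t: "bessel_coeff (x / 2) (k, k + n) = ?t k"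
    "bessel_coeff (x / 2) (k + n, k) = (-1) ^ n * ?t k" for k
    by (simp_all add: bessel_coeff_def add.commute power_add mult_2 power_minus[of "x / 2"] divide_simps)
  let ?A = "{(k, j). int j - int k = int n}" and ?B = "{(k, j). int j - int k = - int n}"
  have A: "(bessel_coeff (x / 2) has_sum infsum (bessel_coeff (x / 2)) ?A) ?A"
    and B: "(bessel_coeff (x / 2) has_sum infsum (bessel_coeff (x / 2)) ?B) ?B"
    using summable_on_subset[OF summable_on_bessel_coeff] by auto
  have "(?t has_sum infsum (bessel_coeff (x / 2)) ?A) UNIV"
    by (rule has_sum_reindex_bij_witness[where i = "fst" and j = "\<lambda>k. (k, k + n)", THEN iffD2,
          OF _ _ _ _ _ refl A]) (use t in auto)
  then have s: "?t sums infsum (bessel_coeff (x / 2)) ?A"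
    by (rule has_sum_imp_sums)
  then show sA: "infsum (bessel_coeff (x / 2)) ?A = Bessel_J n x"
    by (simp add: Bessel_J_def sums_iff)
  with s show "?t sums Bessel_J n x"
    by simp
  have "((\<lambda>k. (-1) ^ n * ?t k) has_sum infsum (bessel_coeff (x / 2)) ?B) UNIV"
    by (rule has_sum_reindex_bij_witness[where i = "snd" and j = "\<lambda>k. (k + n, k)", THEN iffD2,
          OF _ _ _ _ _ refl B]) (use t in auto)
  then have "(\<lambda>k. (-1) ^ n * ?t k) sums infsum (bessel_coeff (x / 2)) ?B"
    by (rule has_sum_imp_sums)
  moreover have "(\<lambda>k. (-1) ^ n * ?t k) sums ((-1) ^ n * Bessel_J n x)"
    using s sA by (intro sums_mult) simp
  ultimately show "infsum (bessel_coeff (x / 2)) ?B = (-1) ^ n * Bessel_J n x"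
    by (rule sums_unique2)
qed

lemma infsum_bessel_coeff_diff:
  "infsum (bessel_coeff (x / 2)) {(k, j). int j - int k = n} = bessel_Z n x"
  using infsum_bessel_coeff_diff_nonneg[of x "nat n"] infsum_bessel_coeff_diff_nonpos[of x "nat (- n)"]
  by (auto simp: bessel_Z_def)

text \<open>In terms of generating functions this is exp(-y t) exp(y t) = 1: the antidiagonal sum is
  (-y + y)^n / n!.\<close>

lemma infsum_bessel_coeff_add:
  "infsum (bessel_coeff y) {(k, j). int j + int k = n} = of_bool (n = 0)"
proof (cases "n \<ge> 0")
  case True
  define N where "N = nat n"
  have "infsum (bessel_coeff y) {(k, j). int j + int k = n}
      = infsum (\<lambda>k. bessel_coeff y (k, N - k)) {..N}"
    by (rule infsum_reindex_bij_witness[where i = "\<lambda>k. (k, N - k)" and j = fst])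
      (use True in \<open>auto simp: N_def nat_add_distrib\<close>)
  also have "\<dots> = (\<Sum>k\<le>N. of_nat (N choose k) * (- y) ^ k * y ^ (N - k)) / fact N"
    unfolding infsum_finite[OF finite_atMost] sum_divide_distrib
    by (rule sum.cong) (auto simp: bessel_coeff_def binomial_fact field_simps)
  also have "\<dots> = (- y + y) ^ N / fact N"
    by (simp only: binomial_ring)
  also have "\<dots> = of_bool (n = 0)"
    using True by (auto simp: N_def power_0_left)
  finally show ?thesis .
next
  case False
  then have "{(k, j). int j + int k = n} = {}"
    by auto
  with False show ?thesis
    by simp
qed

text \<open>Exchanging the two components \<open>j\<close> and \<open>j'\<close> of the pairs turns the correlation of the
  coefficients along differences, which is the left-hand side, into one along sums, which is
  trivial by the binomial theorem.\<close>

lemma has_sum_bessel_Z_mult: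
  "((\<lambda>n. bessel_Z n x * bessel_Z (n + \<nu>) x) has_sum of_bool (\<nu> = 0)) UNIV"
proof -
  let ?c = "bessel_coeff (x / 2)"
  let ?d = "\<lambda>(k, j). int j - int k" and ?s = "\<lambda>(k, j). int j + int k"
  have Z: "((\<lambda>n. bessel_Z n x * bessel_Z (n + \<nu>) x) has_sum
           (\<Sum>\<^sub>\<infinity>(p, q) | ?d q = ?d p + \<nu>. ?c p * ?c q)) UNIV"
    using has_sum_correlation[OF summable_on_bessel_coeff[of "x / 2"], where g = ?d and \<nu> = \<nu>]
    using infsum_bessel_coeff_diff by (simp add: case_prod_unfold)
  have S: "((\<lambda>n. of_bool (n = 0) * of_bool (n + - \<nu> = 0)) has_sum
           (\<Sum>\<^sub>\<infinity>(p, q) | ?s q = ?s p + - \<nu>. ?c p * ?c q)) (UNIV :: int set)"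
    using has_sum_correlation[OF summable_on_bessel_coeff[of "x / 2"], where g = ?s and \<nu> = "- \<nu>"]
    using infsum_bessel_coeff_add by (simp add: case_prod_unfold)
  have \<delta>: "((\<lambda>n. of_bool (n = 0) * of_bool (n + - \<nu> = 0)) has_sum (of_bool (\<nu> = 0) :: real)) (UNIV :: int set)"
    by (rule has_sum_finite_neutralI[of "{0}"]) auto
  \<comment> \<open>The condition j' - k' = j - k + \<nu> is the same as j + k' = k + j' -
    \<nu>.\<close>
  have "(\<Sum>\<^sub>\<infinity>(p, q) | ?d q = ?d p + \<nu>. ?c p * ?c q) = (\<Sum>\<^sub>\<infinity>(p, q) | ?s q = ?s p + - \<nu>. ?c p * ?c q)"
    by (rule infsum_reindex_bij_witness
          [where i = "\<lambda>((k, j'), (k', j)). ((k, j), (k', j'))" and j = "\<lambda>((k, j), (k', j')). ((k, j'), (k', j))"])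
      (auto simp: bessel_coeff_def mult_ac)
  also have "\<dots> = of_bool (\<nu> = 0)"
    by (rule has_sum_unique[OF S \<delta>])
  finally show ?thesis
    using Z by (simp only:)
qed

text \<open>In the series of 2 (n+1) J_(n+1) - x J_n the terms of index 0 cancel, and the term of
  index k+1 is x times the term of index k of J_(n+2).\<close>

lemma Bessel_J_recurrence:
  "2 * real (Suc n) * Bessel_J (Suc n) x = x * (Bessel_J n x + Bessel_J (Suc (Suc n)) x)"
proof -
  let ?t = "\<lambda>n k. (-1) ^ k / (fact k * fact (n + k)) * (x / 2) ^ (2 * k + n)"
  define y where "y = x / 2"
  have x: "x = 2 * y"
    by (simp add: y_def)
  define u where "u = (\<lambda>k. 2 * real (Suc n) * ?t (Suc n) k - x * ?t n k)"
  have "u sums (2 * real (Suc n) * Bessel_J (Suc n) x - x * Bessel_J n x)"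
    unfolding u_def by (intro sums_diff sums_mult Bessel_J_sums)
  moreover have "u 0 = 0"
  proof -
    have "real (Suc n) / fact (Suc n) = 1 / fact n"
      by (simp add: divide_simps)
    moreover have "u 0 = 2 * (real (Suc n) / fact (Suc n)) * y ^ Suc n - 2 * y * (y ^ n / fact n)"
      unfolding u_def x by (simp del: fact_Suc of_nat_Suc)
    ultimately show ?thesis
      by simp
  qed
  ultimately have "(\<lambda>k. u (Suc k)) sums (2 * real (Suc n) * Bessel_J (Suc n) x - x * Bessel_J n x)"
    by (simp only: sums_Suc_iff add_0_right)
  moreover have "u (Suc k) = x * ?t (Suc (Suc n)) k" for k
  proof -
    let ?e = "y ^ (2 * Suc k + Suc n)"
    have eq: "real (Suc n) / (fact (Suc k) * fact (Suc n + Suc k)) - 1 / (fact (Suc k) * fact (n + Suc k))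
        = - (1 / (fact k * fact (Suc (Suc n) + k)) :: real)"
      by (simp add: divide_simps)
    have "u (Suc k) = 2 * (-1) ^ Suc k * ?e *
        (real (Suc n) / (fact (Suc k) * fact (Suc n + Suc k)) - 1 / (fact (Suc k) * fact (n + Suc k)))"
      unfolding u_def x by (simp add: right_diff_distrib mult_ac del: fact_Suc of_nat_Suc)
    also have "\<dots> = 2 * (-1) ^ Suc k * ?e * (- (1 / (fact k * fact (Suc (Suc n) + k))))"
      unfolding eq ..
    also have "\<dots> = x * ?t (Suc (Suc n)) k"
      unfolding x by (simp del: fact_Suc)
    finally show ?thesis .
  qed
  ultimately have "(\<lambda>k. x * ?t (Suc (Suc n)) k) sums (2 * real (Suc n) * Bessel_J (Suc n) x - x * Bessel_J n x)"
    by (simp only:)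
  then have "2 * real (Suc n) * Bessel_J (Suc n) x - x * Bessel_J n x = x * Bessel_J (Suc (Suc n)) x"
    by (rule sums_unique2) (intro sums_mult Bessel_J_sums)
  then show ?thesis
    by (simp add: distrib_left del: of_nat_Suc)
qed

lemma bessel_Z_recurrence:
  "2 * of_int n * bessel_Z n x = x * (bessel_Z (n - 1) x + bessel_Z (n + 1) x)"
proof -
  consider m where "n = int (Suc m)" | "n = 0" | m where "n = - int (Suc m)"
    by (metis int_cases3 not0_implies_Suc of_nat_0_less_iff less_numeral_extra(3))
  then show ?thesis
  proof cases
    case (1 m)
    then have "nat (n - 1) = m" "nat n = Suc m" "nat (n + 1) = Suc (Suc m)"
      by auto
    with 1 Bessel_J_recurrence[of m x] show ?thesis
      by (simp add: bessel_Z_def)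
  next
    case 2
    then show ?thesis
      by (simp add: bessel_Z_def)
  next
    case (3 m)
    then have n: "nat (- (n + 1)) = m" "nat (- n) = Suc m" "nat (- (n - 1)) = Suc (Suc m)"
      by auto
    \<comment> \<open>Both branches of the definition agree at order 0, so this also covers n + 1 =
      0.\<close>
    have neg: "bessel_Z i x = (-1) ^ nat (- i) * Bessel_J (nat (- i)) x" if "i \<le> 0" for i
      using that by (auto simp: bessel_Z_def)
    have b: "bessel_Z n x = (-1) ^ Suc m * Bessel_J (Suc m) x"
      "bessel_Z (n - 1) x = (-1) ^ m * Bessel_J (Suc (Suc m)) x"
      "bessel_Z (n + 1) x = (-1) ^ m * Bessel_J m x"
      using 3 n by (subst neg; simp)+
    have "of_int n = - real (Suc m)"
      using 3 by simp
    then have "2 * of_int n * bessel_Z n x = (-1) ^ m * (2 * real (Suc m) * Bessel_J (Suc m) x)"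
      unfolding b(1) by (simp del: of_nat_Suc)
    then show ?thesis
      unfolding Bessel_J_recurrence b by (simp add: algebra_simps)
  qed
qed

subsection \<open>Moments\<close>

text \<open>As cos(n u) is the Chebyshev polynomial T_n at cos u, this is the mean of
  \<open>\<phi>\<close> times T_|\<nu>| under the arcsine law on [-1, 1]. The angular form avoids
  the singular density.\<close>

definition cosine_mean :: "int \<Rightarrow> (real \<Rightarrow> real) \<Rightarrow> real" where
  "cosine_mean \<nu> \<phi> = integral {0..pi} (\<lambda>u. \<phi> (cos u) * cos (of_int \<nu> * u)) / pi"

text \<open>Addition formula for the cosine. Integrability is assumed rather than continuity because
  the lemma is also applied to \<open>pos_powr \<alpha>\<close>, which jumps at 0 for \<alpha> =
  0.\<close>

lemma cosine_mean_recurrence: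
  assumes "(\<lambda>u. \<phi> (cos u) * cos (of_int (\<nu> + 1) * u)) integrable_on {0..pi}"
    and "(\<lambda>u. \<phi> (cos u) * cos (of_int (\<nu> - 1) * u)) integrable_on {0..pi}"
  shows "cosine_mean (\<nu> + 1) \<phi> + cosine_mean (\<nu> - 1) \<phi> = 2 * cosine_mean \<nu> (\<lambda>x. x * \<phi> x)"
proof -
  have "cos (of_int (\<nu> + 1) * u) + cos (of_int (\<nu> - 1) * u) = 2 * (cos u * cos (of_int \<nu> * u))" for u :: real
    by (simp add: ring_distribs cos_add cos_diff)
  then have eq: "\<phi> (cos u) * cos (of_int (\<nu> + 1) * u) + \<phi> (cos u) * cos (of_int (\<nu> - 1) * u)
      = 2 * (cos u * \<phi> (cos u) * cos (of_int \<nu> * u))" for u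
    by (metis distrib_left mult.assoc mult.left_commute)
  have "integral {0..pi} (\<lambda>u. \<phi> (cos u) * cos (of_int (\<nu> + 1) * u))
      + integral {0..pi} (\<lambda>u. \<phi> (cos u) * cos (of_int (\<nu> - 1) * u))
      = 2 * integral {0..pi} (\<lambda>u. cos u * \<phi> (cos u) * cos (of_int \<nu> * u))"
    by (subst integral_add[OF assms, symmetric]) (simp only: eq integral_mult_right)
  then show ?thesis
    by (simp add: cosine_mean_def flip: add_divide_distrib)
qed

lemma cosine_mean_const: "cosine_mean \<nu> (\<lambda>x. a) = (if \<nu> = 0 then a else 0)"
proof (cases "\<nu> = 0")
  case False
  have "((\<lambda>u. a * cos (of_int \<nu> * u)) has_integral
      a * sin (of_int \<nu> * pi) / of_int \<nu> - a * sin (of_int \<nu> * 0) / of_int \<nu>) {0..pi}"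
    using False
    by (intro fundamental_theorem_of_calculus)
      (auto intro!: derivative_eq_intros simp: has_real_derivative_iff_has_vector_derivative[symmetric])
  moreover have "sin (of_int \<nu> * pi) = 0"
    by (simp add: sin_times_pi_eq_0)
  ultimately show ?thesis
    using False by (auto simp: cosine_mean_def dest: integral_unique)
qed (simp add: cosine_mean_def)

lemma cosine_mean_sum:
  assumes "\<And>i. i \<in> I \<Longrightarrow> continuous_on {-1..1} (f i)" "finite I"
  shows "cosine_mean \<nu> (\<lambda>x. \<Sum>i\<in>I. a i * f i x) = (\<Sum>i\<in>I. a i * cosine_mean \<nu> (f i))"
proof -
  have "(\<lambda>u. a i * (f i (cos u) * cos (of_int \<nu> * u))) integrable_on {0..pi}" if "i \<in> I" for i
    by (intro integrable_continuous_real continuous_intros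
        continuous_on_compose2[OF assms(1)[OF that]]) auto
  then show ?thesis
    using assms(2)
    by (simp add: cosine_mean_def sum_distrib_right mult.assoc integral_sum sum_divide_distrib)
qed

text \<open>Writing one factor as n/r + c/r, the recurrence replaces (n/r) J_n by neighbouring
  orders. Reindexing n by one then changes both \<open>c\<close> and \<open>\<nu>\<close> by one, so
  the induction runs over all shifts and all \<open>\<nu>\<close> at once; the remaining term has
  the factor c/r and disappears in the limit.\<close>

lemma bessel_Z_moment:
  fixes c :: real
  shows bessel_Z_moment_summable:
    "r > 0 \<Longrightarrow> (\<lambda>n. ((of_int n + c) / r) ^ k * (bessel_Z n r * bessel_Z (n + \<nu>) r)) summable_on UNIV"
  and bessel_Z_moment_tendsto:
    "((\<lambda>r. \<Sum>\<^sub>\<infinity>n. ((of_int n + c) / r) ^ k * (bessel_Z n r * bessel_Z (n + \<nu>) r)) \<longlongrightarrow>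
       cosine_mean \<nu> (\<lambda>x. x ^ k)) at_top"
proof -
  define t where "t k c \<nu> r n = ((of_int n + c) / r) ^ k * (bessel_Z n r * bessel_Z (n + \<nu>) r)"
    for k c \<nu> r n
  have "(\<forall>r>0. t k c \<nu> r summable_on UNIV) \<and>
      ((\<lambda>r. infsum (t k c \<nu> r) UNIV) \<longlongrightarrow> cosine_mean \<nu> (\<lambda>x. x ^ k)) at_top"
  proof (induction k arbitrary: c \<nu>)
    case 0
    have "(t 0 c \<nu> r has_sum of_bool (\<nu> = 0)) UNIV" for r
      using has_sum_bessel_Z_mult[of r \<nu>] by (simp add: t_def[abs_def])
    then show ?case
      by (auto simp: cosine_mean_const has_sum_iff)
  next
    case (Suc k)
    let ?M = "\<lambda>c \<nu> r. infsum (t k c \<nu> r) UNIV"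
    let ?S = "\<lambda>r. ?M (c + 1) (\<nu> + 1) r / 2 + ?M (c - 1) (\<nu> - 1) r / 2 + c / r * ?M c \<nu> r"
    have step: "(t (Suc k) c \<nu> r has_sum ?S r) UNIV" if r: "r > 0" for r
    proof -
      have M: "(t k c' \<nu>' r has_sum ?M c' \<nu>' r) UNIV" for c' \<nu>'
        using Suc.IH r by simp
      have 1: "((\<lambda>n. t k (c + 1) (\<nu> + 1) r (n - 1)) has_sum ?M (c + 1) (\<nu> + 1) r) UNIV"
        by (rule has_sum_reindex_bij_witness[where i = "\<lambda>n. n + 1" and j = "\<lambda>n. n - 1", THEN iffD2,
              OF _ _ _ _ _ refl M]) auto
      have 2: "((\<lambda>n. t k (c - 1) (\<nu> - 1) r (n + 1)) has_sum ?M (c - 1) (\<nu> - 1) r) UNIV"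
        by (rule has_sum_reindex_bij_witness[where i = "\<lambda>n. n - 1" and j = "\<lambda>n. n + 1", THEN iffD2,
              OF _ _ _ _ _ refl M]) auto
      have eq: "t (Suc k) c \<nu> r n = t k (c + 1) (\<nu> + 1) r (n - 1) * (1 / 2)
          + t k (c - 1) (\<nu> - 1) r (n + 1) * (1 / 2) + c / r * t k c \<nu> r n" for n
      proof -
        have "(of_int n + c) / r * bessel_Z n r
            = bessel_Z (n - 1) r * (1 / 2) + bessel_Z (n + 1) r * (1 / 2) + c / r * bessel_Z n r"
          using bessel_Z_recurrence[of n r] r by (simp add: field_simps)
        then have "((of_int n + c) / r) ^ k * bessel_Z (n + \<nu>) r * ((of_int n + c) / r * bessel_Z n r)
            = ((of_int n + c) / r) ^ k * bessel_Z (n + \<nu>) r *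
              (bessel_Z (n - 1) r * (1 / 2) + bessel_Z (n + 1) r * (1 / 2) + c / r * bessel_Z n r)"
          by simp
        then show ?thesis
          by (simp add: t_def ring_distribs mult_ac)
      qed
      show ?thesis
        unfolding eq using has_sum_add[OF has_sum_add[OF has_sum_cmult_left[OF 1, of "1 / 2"]
              has_sum_cmult_left[OF 2, of "1 / 2"]] has_sum_cmult_right[OF M, of "c / r"]]
        by simp
    qed
    have int: "(\<lambda>u. cos u ^ k * cos (of_int \<mu> * u)) integrable_on {0..pi}" for \<mu>
      by (intro integrable_continuous_real continuous_intros)
    have "(?S \<longlongrightarrow> cosine_mean (\<nu> + 1) (\<lambda>x. x ^ k) / 2 + cosine_mean (\<nu> - 1) (\<lambda>x. x ^ k) / 2
        + 0 * cosine_mean \<nu> (\<lambda>x. x ^ k)) at_top"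
      using Suc.IH by (intro tendsto_intros real_tendsto_divide_at_top[OF tendsto_const filterlim_ident]) auto
    moreover have "cosine_mean (\<nu> + 1) (\<lambda>x. x ^ k) / 2 + cosine_mean (\<nu> - 1) (\<lambda>x. x ^ k) / 2
        + 0 * cosine_mean \<nu> (\<lambda>x. x ^ k) = cosine_mean \<nu> (\<lambda>x. x ^ Suc k)"
      using cosine_mean_recurrence[OF int int, of \<nu>] by simp
    ultimately have "(?S \<longlongrightarrow> cosine_mean \<nu> (\<lambda>x. x ^ Suc k)) at_top"
      by (simp only:)
    moreover have "\<forall>\<^sub>F r in at_top. ?S r = infsum (t (Suc k) c \<nu> r) UNIV"
      using eventually_gt_at_top[of 0] by eventually_elim (simp add: infsumI[OF step])
    ultimately have "((\<lambda>r. infsum (t (Suc k) c \<nu> r) UNIV) \<longlongrightarrow> cosine_mean \<nu> (\<lambda>x. x ^ Suc k)) at_top"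
      by (rule Lim_transform_eventually)
    then show ?case
      using step has_sum_imp_summable by blast
  qed
  then show "r > 0 \<Longrightarrow> (\<lambda>n. ((of_int n + c) / r) ^ k * (bessel_Z n r * bessel_Z (n + \<nu>) r)) summable_on UNIV"
    and "((\<lambda>r. \<Sum>\<^sub>\<infinity>n. ((of_int n + c) / r) ^ k * (bessel_Z n r * bessel_Z (n + \<nu>) r)) \<longlongrightarrow>
       cosine_mean \<nu> (\<lambda>x. x ^ k)) at_top"
    by (auto simp: t_def[abs_def])
qed

section \<open>From moments to polynomials and to weights dominated by them\<close>

lemma bessel_Z_polynomial_summable:
    "real_polynomial_function p \<Longrightarrow> r > 0 \<Longrightarrow>
      (\<lambda>n. p ((of_int n + c) / r) * (bessel_Z n r * bessel_Z (n + \<nu>) r)) summable_on UNIV"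
  and bessel_Z_polynomial_tendsto:
    "real_polynomial_function p \<Longrightarrow>
      ((\<lambda>r. \<Sum>\<^sub>\<infinity>n. p ((of_int n + c) / r) * (bessel_Z n r * bessel_Z (n + \<nu>) r)) \<longlongrightarrow>
       cosine_mean \<nu> p) at_top"
proof -
  assume "real_polynomial_function p"
  then obtain a d where p: "p = (\<lambda>x. \<Sum>i\<le>d. a i * x ^ i)"
    by (auto simp: real_polynomial_function_iff_sum)
  let ?m = "\<lambda>i r n. ((of_int n + c) / r) ^ i * (bessel_Z n r * bessel_Z (n + \<nu>) r)"
  have s: "((\<lambda>n. p ((of_int n + c) / r) * (bessel_Z n r * bessel_Z (n + \<nu>) r)) has_sum
      (\<Sum>i\<le>d. a i * infsum (?m i r) UNIV)) UNIV" if "r > 0" for r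
  proof -
    have "((\<lambda>n. \<Sum>i\<in>I. a i * ?m i r n) has_sum (\<Sum>i\<in>I. a i * infsum (?m i r) UNIV)) UNIV"
      if "finite I" for I
      using that
      by induction (auto intro!: has_sum_add has_sum_cmult_right has_sum_infsum
          bessel_Z_moment_summable \<open>r > 0\<close>)
    from this[of "{..d}"] show ?thesis
      by (simp add: p sum_distrib_right mult.assoc)
  qed
  then show "r > 0 \<Longrightarrow>
      (\<lambda>n. p ((of_int n + c) / r) * (bessel_Z n r * bessel_Z (n + \<nu>) r)) summable_on UNIV"
    using has_sum_imp_summable by blast
  have "((\<lambda>r. \<Sum>i\<le>d. a i * infsum (?m i r) UNIV) \<longlongrightarrow> (\<Sum>i\<le>d. a i * cosine_mean \<nu> (\<lambda>x. x ^ i))) at_top"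
    by (intro tendsto_intros bessel_Z_moment_tendsto)
  also have "(\<Sum>i\<le>d. a i * cosine_mean \<nu> (\<lambda>x. x ^ i)) = cosine_mean \<nu> p"
    unfolding p by (intro cosine_mean_sum[symmetric] continuous_intros) auto
  finally show "((\<lambda>r. \<Sum>\<^sub>\<infinity>n. p ((of_int n + c) / r) * (bessel_Z n r * bessel_Z (n + \<nu>) r)) \<longlongrightarrow>
       cosine_mean \<nu> p) at_top"
    by (rule Lim_transform_eventually)
      (use eventually_gt_at_top[of 0] in eventually_elim, simp add: infsumI[OF s])
qed

text \<open>By \<open>\<bar>a * b\<bar> \<le> (a\<^sup>2 + b\<^sup>2) / 2\<close> the products with \<open>\<nu> \<noteq> 0\<close> are dominated by squares; reindexing the second
  square replaces \<open>c\<close> by \<open>c - \<nu>\<close>, which does not affect the limit.\<close>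

lemma bessel_Z_majorant:
  fixes c :: real and \<nu> :: int
  assumes q: "real_polynomial_function q"
  defines "B \<equiv> \<lambda>r. ((\<Sum>\<^sub>\<infinity>n. q ((of_int n + c) / r) * (bessel_Z n r * bessel_Z (n + 0) r))
                 + (\<Sum>\<^sub>\<infinity>n. q ((of_int n + (c - of_int \<nu>)) / r) * (bessel_Z n r * bessel_Z (n + 0) r))) / 2"
  shows bessel_Z_majorant_tendsto: "(B \<longlongrightarrow> cosine_mean 0 q) at_top"
    and bessel_Z_majorant_summable:
      "\<And>r d. r > 0 \<Longrightarrow> (\<And>n. \<bar>d n\<bar> \<le> q ((of_int n + c) / r)) \<Longrightarrow>
        (\<lambda>n. d n * (bessel_Z n r * bessel_Z (n + \<nu>) r)) summable_on UNIV"
    and bessel_Z_majorant_bound: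
      "\<And>r d. r > 0 \<Longrightarrow> (\<And>n. \<bar>d n\<bar> \<le> q ((of_int n + c) / r)) \<Longrightarrow>
        \<bar>\<Sum>\<^sub>\<infinity>n. d n * (bessel_Z n r * bessel_Z (n + \<nu>) r)\<bar> \<le> B r"
proof -
  have "(B \<longlongrightarrow> (cosine_mean 0 q + cosine_mean 0 q) / 2) at_top"
    unfolding B_def by (intro tendsto_intros bessel_Z_polynomial_tendsto[OF q]) auto
  then show "(B \<longlongrightarrow> cosine_mean 0 q) at_top"
    by simp
next
  fix r :: real and d :: "int \<Rightarrow> real"
  assume r: "r > 0" and d: "\<And>n. \<bar>d n\<bar> \<le> q ((of_int n + c) / r)"
  let ?f = "\<lambda>c n. q ((of_int n + c) / r) * (bessel_Z n r * bessel_Z (n + 0) r)"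
  let ?g = "\<lambda>n. (?f c n + ?f (c - of_int \<nu>) (n + \<nu>)) * (1 / 2)"
  let ?h = "\<lambda>n. d n * (bessel_Z n r * bessel_Z (n + \<nu>) r)"
  have f: "(?f c' has_sum infsum (?f c') UNIV) UNIV" for c'
    by (intro has_sum_infsum bessel_Z_polynomial_summable[OF q r])
  have "((\<lambda>n. ?f (c - of_int \<nu>) (n + \<nu>)) has_sum infsum (?f (c - of_int \<nu>)) UNIV) UNIV"
    by (rule has_sum_reindex_bij_witness[where i = "\<lambda>n. n - \<nu>" and j = "\<lambda>n. n + \<nu>", THEN iffD2,
          OF _ _ _ _ _ refl f]) auto
  from has_sum_cmult_left[OF has_sum_add[OF f[of c] this], of "1 / 2"]
  have g: "(?g has_sum B r) UNIV"
    by (simp add: B_def)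
  have h: "\<bar>?h n\<bar> \<le> ?g n" for n
  proof -
    have "\<bar>bessel_Z n r * bessel_Z (n + \<nu>) r\<bar> \<le> ((bessel_Z n r)\<^sup>2 + (bessel_Z (n + \<nu>) r)\<^sup>2) / 2"
      using sum_squares_bound[of "\<bar>bessel_Z n r\<bar>" "\<bar>bessel_Z (n + \<nu>) r\<bar>"] by (simp add: abs_mult)
    with d[of n] have "\<bar>?h n\<bar> \<le> q ((of_int n + c) / r) * (((bessel_Z n r)\<^sup>2 + (bessel_Z (n + \<nu>) r)\<^sup>2) / 2)"
      unfolding abs_mult[of "d n"] by (intro mult_mono) auto
    also have "\<dots> = ?g n"
      by (simp add: power2_eq_square algebra_simps)
    finally show ?thesis .
  qed
  have ha: "(\<lambda>n. \<bar>?h n\<bar>) summable_on UNIV"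
    by (rule summable_on_comparison_test[OF has_sum_imp_summable[OF g]]) (use h in auto)
  then show hs: "?h summable_on UNIV"
    using summable_on_iff_abs_summable_on_real by fastforce
  have "\<bar>infsum ?h UNIV\<bar> \<le> (\<Sum>\<^sub>\<infinity>n. \<bar>?h n\<bar>)"
    using norm_has_sum_bound[of ?h UNIV] has_sum_infsum[OF ha] has_sum_infsum[OF hs] by fastforce
  also have "\<dots> \<le> B r"
    by (rule has_sum_mono[OF has_sum_infsum[OF ha] g h])
  finally show "\<bar>infsum ?h UNIV\<bar> \<le> B r" .
qed

subsection \<open>Polynomial approximation\<close>

lemma cosine_mean_0_add_const:
  assumes "continuous_on {-1..1} f"
  shows "cosine_mean 0 (\<lambda>x. a + f x) = a + cosine_mean 0 f"
proof -
  have "(\<lambda>u. f (cos u)) integrable_on {0..pi}"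
    by (intro integrable_continuous_real continuous_intros continuous_on_compose2[OF assms]) auto
  from integral_add[OF integrable_const_ivl this, of a] show ?thesis
    by (simp add: cosine_mean_def add_divide_distrib)
qed

lemma cosine_mean_0_mono:
  assumes "continuous_on {-1..1} f" "continuous_on {-1..1} g" "\<And>x. \<bar>x\<bar> \<le> 1 \<Longrightarrow> f x \<le> g x"
  shows "cosine_mean 0 f \<le> cosine_mean 0 g"
proof -
  have "(\<lambda>u. f (cos u)) integrable_on {0..pi}" "(\<lambda>u. g (cos u)) integrable_on {0..pi}"
    by (intro integrable_continuous_real continuous_intros continuous_on_compose2[OF assms(1)]
        continuous_on_compose2[OF assms(2)]; force)+
  then show ?thesis
    unfolding cosine_mean_def
    by (intro divide_right_mono) (auto intro!: integral_le assms(3))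
qed

text \<open>Since |cos(\<nu> u)| \<le> 1, the error majorant can be measured by the positive mean
  \<open>cosine_mean 0\<close>, whatever \<open>\<nu>\<close> is.\<close>

lemma cosine_mean_diff_le:
  assumes w: "(\<lambda>u. w (cos u) * cos (of_int \<nu> * u)) integrable_on {0..pi}"
    and p: "continuous_on {-1..1} p" and q: "continuous_on {-1..1} q"
    and wp: "\<And>x. \<bar>x\<bar> \<le> 1 \<Longrightarrow> \<bar>w x - p x\<bar> \<le> q x"
  shows "\<bar>cosine_mean \<nu> w - cosine_mean \<nu> p\<bar> \<le> cosine_mean 0 q"
proof -
  have ip: "(\<lambda>u. p (cos u) * cos (of_int \<nu> * u)) integrable_on {0..pi}"
    and iq: "(\<lambda>u. q (cos u)) integrable_on {0..pi}"
    by (intro integrable_continuous_real continuous_intros continuous_on_compose2[OF p]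
        continuous_on_compose2[OF q]; force)+
  have "norm (integral {0..pi} (\<lambda>u. w (cos u) * cos (of_int \<nu> * u) - p (cos u) * cos (of_int \<nu> * u)))
      \<le> integral {0..pi} (\<lambda>u. q (cos u))"
  proof (rule integral_norm_bound_integral[OF integrable_diff[OF w ip] iq])
    fix u :: real
    have "\<bar>w (cos u) - p (cos u)\<bar> * \<bar>cos (of_int \<nu> * u)\<bar> \<le> q (cos u) * 1"
      using wp[of "cos u"] by (intro mult_mono) auto
    then show "norm (w (cos u) * cos (of_int \<nu> * u) - p (cos u) * cos (of_int \<nu> * u)) \<le> q (cos u)"
      by (simp flip: left_diff_distrib abs_mult)
  qed
  then show ?thesis
    by (simp add: cosine_mean_def integral_diff[OF w ip] divide_right_mono flip: diff_divide_distrib)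
qed

text \<open>With x = cos u the integrand is a power of sin u, which is bounded by 1 and tends to 0
  except at u = pi/2, a null set. These polynomials equal 1 at x = 0 yet are small in mean, so they
  can cover a jump at 0.\<close>

lemma cosine_mean_0_sin_power_tendsto_0: "(\<lambda>N. cosine_mean 0 (\<lambda>x. (1 - x\<^sup>2) ^ (2 * N))) \<longlonglongrightarrow> 0"
proof -
  have s: "(1 - (cos u)\<^sup>2) = (sin u)\<^sup>2" for u :: real
    by (simp add: sin_squared_eq)
  have "(\<lambda>N. integral {0..pi} (\<lambda>u. ((sin u)\<^sup>2) ^ (2 * N))) \<longlonglongrightarrow>
      integral {0..pi} (\<lambda>u. if u = pi / 2 then 1 else 0 :: real)"
  proof (rule dominated_convergence(2)[where h = "\<lambda>_. 1"])
    fix u :: real assume u: "u \<in> {0..pi}"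
    show "(\<lambda>N. ((sin u)\<^sup>2) ^ (2 * N)) \<longlonglongrightarrow> (if u = pi / 2 then 1 else 0)"
    proof (cases "u = pi / 2")
      case False
      with u have "cos u \<noteq> 0"
        using cos_inj_pi[of u "pi / 2"] by auto
      then have "(sin u) ^ 4 < 1"
        using sin_cos_squared_add[of u] power_strict_mono[of "(sin u)\<^sup>2" 1 2]
        by (smt (verit) one_power2 pos2 power2_eq_square power_even_abs power4_eq_xxxx mult.assoc zero_less_power2 zero_le_power2)
      then have "(\<lambda>N. ((sin u) ^ 4) ^ N) \<longlonglongrightarrow> 0"
        by (intro LIMSEQ_power_zero) auto
      with False show ?thesis
        by (simp flip: power_mult)
    next
      case True
      then have "sin u = 1"
        by (simp only: sin_pi_half)
      with True show ?thesis
        by simp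
    qed
  next
    fix N :: nat and u :: real
    show "norm (((sin u)\<^sup>2) ^ (2 * N)) \<le> 1"
      by (simp add: power_abs power_le_one flip: power_mult)
  qed (auto intro!: integrable_continuous_real continuous_intros)
  also have "integral {0..pi} (\<lambda>u. if u = pi / 2 then 1 else 0 :: real) = integral {0..pi} (\<lambda>u. 0)"
    by (rule integral_spike[of "{pi / 2}"]) auto
  finally have "(\<lambda>N. integral {0..pi} (\<lambda>u. ((sin u)\<^sup>2) ^ (2 * N)) / pi) \<longlonglongrightarrow> 0 / pi"
    by (intro tendsto_intros) auto
  then show ?thesis
    by (simp add: cosine_mean_def s)
qed

lemma real_polynomial_function_growth:
  fixes p :: "real \<Rightarrow> real"
  assumes "real_polynomial_function p"
  obtains C d where "C \<ge> 0" "\<And>x. \<bar>x\<bar> \<ge> 1 \<Longrightarrow> \<bar>p x\<bar> \<le> C * \<bar>x\<bar> ^ d"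
proof -
  obtain a d where p: "p = (\<lambda>x. \<Sum>i\<le>d. a i * x ^ i)"
    using assms by (auto simp: real_polynomial_function_iff_sum)
  have "\<bar>p x\<bar> \<le> (\<Sum>i\<le>d. \<bar>a i\<bar>) * \<bar>x\<bar> ^ d" if "\<bar>x\<bar> \<ge> 1" for x
  proof -
    have "\<bar>p x\<bar> \<le> (\<Sum>i\<le>d. \<bar>a i * x ^ i\<bar>)"
      unfolding p by (rule sum_abs)
    also have "\<dots> \<le> (\<Sum>i\<le>d. \<bar>a i\<bar> * \<bar>x\<bar> ^ d)"
      using that by (intro sum_mono) (auto simp: abs_mult power_abs intro!: mult_left_mono power_increasing)
    finally show ?thesis
      by (simp add: sum_distrib_right)
  qed
  with that[of "\<Sum>i\<le>d. \<bar>a i\<bar>" d] show ?thesis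
    by (simp add: sum_nonneg)
qed

text \<open>For \<alpha> = 0 this is the indicator of the positive half-line, the only discontinuous
  case among \<alpha> \<ge> 0.\<close>

definition pos_powr :: "real \<Rightarrow> real \<Rightarrow> real" where
  "pos_powr \<alpha> x = (if x > 0 then x powr \<alpha> else 0)"

lemma pos_powr_le_power:
  assumes "\<bar>x\<bar> \<ge> 1" "real d \<ge> \<alpha>"
  shows "pos_powr \<alpha> x \<le> \<bar>x\<bar> ^ d"
proof (cases "x > 0")
  case True
  then have "x powr \<alpha> \<le> x powr real d"
    using assms by (intro powr_mono) auto
  with True show ?thesis
    by (simp add: pos_powr_def powr_realpow)
qed (simp add: pos_powr_def)

text \<open>One-sided approximation of the possibly discontinuous function \<open>pos_powr \<alpha>\<close>: it is first
  made continuous near \<open>0\<close>, at a cost bounded by \<open>2 * (1 - x\<^sup>2) ^ (2 * N)\<close>, then Weierstrass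
  applies on \<open>[-2, 2]\<close>, and outside this interval the error is absorbed by a high power of \<open>x / 2\<close>.
  The value \<open>w\<close> is left free near \<open>0\<close> because the sum starts at a fixed index, which is
  only approximately where \<open>x\<close> changes sign.\<close>

lemma pos_powr_polynomial_approx:
  assumes \<alpha>: "\<alpha> \<ge> 0" and \<epsilon>: "\<epsilon> > 0"
  obtains p q :: "real \<Rightarrow> real" and \<delta> :: real
  where "real_polynomial_function p" "real_polynomial_function q" "0 < \<delta>" "\<delta> \<le> 1"
    "cosine_mean 0 q \<le> \<epsilon>"
    "\<And>x w. (\<bar>x\<bar> \<ge> \<delta> \<Longrightarrow> w = pos_powr \<alpha> x) \<Longrightarrow> (\<bar>x\<bar> < \<delta> \<Longrightarrow> 0 \<le> w \<and> w \<le> 1) \<Longrightarrow> \<bar>w - p x\<bar> \<le> q x"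
proof -
  \<comment> \<open>On [-1, 1] the majorant is at most 2 e plus \<open>s\<close>, and
    \<open>s\<close> has mean below 2 e.\<close>
  define e where "e = \<epsilon> / 4"
  have e: "e > 0"
    using \<epsilon> by (simp add: e_def)
  have "\<forall>\<^sub>F N in sequentially. cosine_mean 0 (\<lambda>x. (1 - x\<^sup>2) ^ (2 * N)) < e"
    using order_tendstoD(2)[OF cosine_mean_0_sin_power_tendsto_0 e] .
  then obtain N where N: "cosine_mean 0 (\<lambda>x. (1 - x\<^sup>2) ^ (2 * N)) < e"
    by (auto simp: eventually_sequentially)
  \<comment> \<open>The factor 2 gives \<open>s\<close> > 1 near 0, enough to cover the distance of
    two values in [0, 1]; the even exponent keeps \<open>s\<close> nonnegative outside [-1, 1] as
    well.\<close>
  define s where "s x = 2 * (1 - x\<^sup>2) ^ (2 * N)" for x :: real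
  have s0: "s x \<ge> 0" for x
    by (simp add: s_def power_mult)
  have "((\<lambda>x. s x) \<longlongrightarrow> s 0) (at 0)"
    unfolding s_def by (intro tendsto_intros)
  then have "\<forall>\<^sub>F x in at 0. s x > 1"
    by (rule order_tendstoD) (simp add: s_def)
  then obtain \<delta>' where \<delta>': "\<delta>' > 0" "\<And>x. x \<noteq> 0 \<Longrightarrow> \<bar>x\<bar> < \<delta>' \<Longrightarrow> s x > 1"
    by (auto simp: eventually_at dist_real_def)
  define \<delta> where "\<delta> = min \<delta>' 1"
  have \<delta>: "0 < \<delta>" "\<delta> \<le> 1"
    using \<delta>' by (auto simp: \<delta>_def)
  have s1: "s x \<ge> 1" if "\<bar>x\<bar> < \<delta>" for x
    using \<delta>'(2)[of x] that by (cases "x = 0") (auto simp: \<delta>_def s_def)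
  \<comment> \<open>Zero for x \<le> 0, linear on [0, \<delta>] and x^\<alpha> from \<delta> on. The
    base of \<open>powr\<close> never falls below \<delta>, so this is continuous also for \<alpha>
    < 1.\<close>
  define h where "h x = max x 0 * max x \<delta> powr (\<alpha> - 1)" for x
  have h_eq: "h x = pos_powr \<alpha> x" if "\<bar>x\<bar> \<ge> \<delta>" for x
    using that \<delta> by (cases "x > 0") (auto simp: h_def pos_powr_def powr_diff)
  have h_01: "0 \<le> h x \<and> h x \<le> 1" if "\<bar>x\<bar> < \<delta>" for x
  proof (cases "x > 0")
    case True
    have "x * \<delta> powr (\<alpha> - 1) \<le> \<delta> * \<delta> powr (\<alpha> - 1)"
      using that by (intro mult_right_mono) auto
    also have "\<dots> = \<delta> powr \<alpha>"
      using \<delta> by (simp add: powr_diff)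
    also have "\<dots> \<le> 1"
      using \<delta> \<alpha> by (intro powr_le1) auto
    finally show ?thesis
      using True that by (simp add: h_def)
  qed (use that in \<open>simp add: h_def\<close>)
  have "continuous_on {-2..2} h"
    unfolding h_def using \<delta> by (intro continuous_intros) auto
  then obtain p where p: "real_polynomial_function p" "\<And>x. x \<in> {-2..2} \<Longrightarrow> \<bar>h x - p x\<bar> < e"
    using Stone_Weierstrass_real_polynomial_function[of "{-2..2}" h e] e by auto
  obtain C d where C: "C \<ge> 0" "\<And>x. \<bar>x\<bar> \<ge> 1 \<Longrightarrow> \<bar>p x\<bar> \<le> C * \<bar>x\<bar> ^ d"
    using real_polynomial_function_growth[OF p(1)] by blast
  define D where "D = max d (nat \<lceil>\<alpha>\<rceil>)"
  have D: "real D \<ge> \<alpha>" "d \<le> D"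
    by (auto simp: D_def) linarith
  have tail0: "\<bar>h x - p x\<bar> \<le> (1 + C) * \<bar>x\<bar> ^ D" if x: "\<bar>x\<bar> \<ge> 1" for x
  proof -
    have "\<bar>h x\<bar> \<le> \<bar>x\<bar> ^ D"
      using pos_powr_le_power[OF x D(1)] h_eq[of x] \<delta> x by (simp add: pos_powr_def)
    moreover have "\<bar>p x\<bar> \<le> C * \<bar>x\<bar> ^ D"
      using C(2)[OF x] power_increasing[OF D(2) x] C(1) by (meson mult_left_mono order_trans)
    ultimately show ?thesis
      by (simp add: distrib_right)
  qed
  \<comment> \<open>For |x| \<ge> 2, one factor |x|^K \<ge> 2^K absorbs the constant (1 + C) / e and
    a second one dominates |x|^D. The resulting exponent 2 K is even, so the tail term is
    nonnegative.\<close>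
  obtain K where K: "K \<ge> D" "(1 + C) \<le> e * 2 ^ K"
  proof -
    obtain k where "(1 + C) / e < 2 ^ k"
      using real_arch_pow[of 2] by auto
    moreover have "(2::real) ^ k \<le> 2 ^ max k D"
      by (intro power_increasing) auto
    ultimately have "(1 + C) / e \<le> 2 ^ max k D"
      by linarith
    with e that[of "max k D"] show ?thesis
      by (simp add: divide_simps mult.commute)
  qed
  have tail: "\<bar>h x - p x\<bar> \<le> e * x ^ (2 * K)" if x: "\<bar>x\<bar> \<ge> 2" for x
  proof -
    have "\<bar>h x - p x\<bar> \<le> (1 + C) * \<bar>x\<bar> ^ D"
      using tail0 x by simp
    also have "\<dots> \<le> (e * \<bar>x\<bar> ^ K) * \<bar>x\<bar> ^ K"
    proof (rule mult_mono)
      have "(1 + C) \<le> e * 2 ^ K"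
        by (rule K)
      also have "\<dots> \<le> e * \<bar>x\<bar> ^ K"
        using e x by (intro mult_left_mono power_mono) auto
      finally show "1 + C \<le> e * \<bar>x\<bar> ^ K" .
      show "\<bar>x\<bar> ^ D \<le> \<bar>x\<bar> ^ K"
        using K x by (intro power_increasing) auto
    qed (use e in auto)
    also have "\<dots> = e * x ^ (2 * K)"
      by (simp add: power_mult power2_eq_square flip: power_mult_distrib abs_mult)
    finally show ?thesis .
  qed
  define q where "q x = e + s x + e * x ^ (2 * K)" for x
  have q: "real_polynomial_function q"
    unfolding q_def s_def diff_conv_add_uminus
    by (intro real_polynomial_function.intros real_polynomial_function_power real_polynomial_function_minus
        bounded_linear_ident)
  have hp: "\<bar>h x - p x\<bar> \<le> e + e * x ^ (2 * K)" for x
  proof (cases "\<bar>x\<bar> \<ge> 2")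
    case True
    with tail[of x] e show ?thesis
      by simp
  next
    case False
    then have "\<bar>h x - p x\<bar> < e"
      by (intro p(2)) auto
    moreover have "e * x ^ (2 * K) \<ge> 0"
      using e by simp
    ultimately show ?thesis
      by linarith
  qed
  have cs: "continuous_on A s" for A
    unfolding s_def by (intro continuous_intros)
  have "cosine_mean 0 q \<le> cosine_mean 0 (\<lambda>x. 2 * e + s x)"
  proof (rule cosine_mean_0_mono)
    show "q x \<le> 2 * e + s x" if "\<bar>x\<bar> \<le> 1" for x
    proof -
      have "x ^ (2 * K) \<le> 1"
        using that by (simp add: power_mult power_le_one_iff abs_square_le_1 power_le_one)
      with e show ?thesis
        by (simp add: q_def)
    qed
  qed (auto simp: q_def intro!: continuous_intros cs)
  also have "\<dots> = 2 * e + cosine_mean 0 s"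
    by (rule cosine_mean_0_add_const[OF cs])
  also have "cosine_mean 0 s = 2 * cosine_mean 0 (\<lambda>x. (1 - x\<^sup>2) ^ (2 * N))"
    by (simp add: cosine_mean_def s_def)
  also have "2 * e + \<dots> \<le> \<epsilon>"
    using N by (simp add: e_def)
  finally have "cosine_mean 0 q \<le> \<epsilon>" .
  moreover have "\<bar>w - p x\<bar> \<le> q x"
    if "\<bar>x\<bar> \<ge> \<delta> \<Longrightarrow> w = pos_powr \<alpha> x" "\<bar>x\<bar> < \<delta> \<Longrightarrow> 0 \<le> w \<and> w \<le> 1" for x w
  proof -
    \<comment> \<open>Away from 0 the two values coincide; within \<delta> both lie in [0, 1], where
      \<open>s\<close> \<ge> 1.\<close>
    have "\<bar>w - h x\<bar> \<le> s x"
      using that h_eq[of x] h_01[of x] s0[of x] s1[of x] by (cases "\<bar>x\<bar> \<ge> \<delta>") auto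
    with hp[of x] show ?thesis
      by (simp add: q_def)
  qed
  ultimately show ?thesis
    using that p(1) q \<delta> by blast
qed

text \<open>Both the weights \<open>W r\<close> and the limit function \<open>w\<close> are compared
  with one polynomial \<open>p\<close>. The majorant \<open>q\<close> controls the error on the
  discrete side through \<open>bessel_Z_majorant_bound\<close>, whose bound tends to
  \<open>cosine_mean 0 q\<close>. The weights may depend on r, as long as the estimate eventually
  holds for all n simultaneously.\<close>

lemma bessel_Z_weighted_tendsto:
  fixes W :: "real \<Rightarrow> int \<Rightarrow> real" and c :: real
  assumes w: "(\<lambda>u. w (cos u) * cos (of_int \<nu> * u)) integrable_on {0..pi}"
    and approx: "\<And>\<epsilon>. \<epsilon> > 0 \<Longrightarrow> \<exists>p q. real_polynomial_function p \<and> real_polynomial_function q \<and>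
      cosine_mean 0 q \<le> \<epsilon> \<and> (\<forall>x. \<bar>w x - p x\<bar> \<le> q x) \<and>
      (\<forall>\<^sub>F r in at_top. \<forall>n. \<bar>W r n - p ((of_int n + c) / r)\<bar> \<le> q ((of_int n + c) / r))"
  shows "((\<lambda>r. \<Sum>\<^sub>\<infinity>n. W r n * (bessel_Z n r * bessel_Z (n + \<nu>) r)) \<longlongrightarrow> cosine_mean \<nu> w) at_top"
proof (rule tendstoI)
  fix e :: real assume e: "e > 0"
  then obtain p q where p: "real_polynomial_function p" and q: "real_polynomial_function q"
    \<comment> \<open>Budget: e/2 for the discrete error, with slack because e/4 is only reached in
      the limit, e/4 for the polynomial sum, and e/4 for the limit functional.\<close>
    and qe: "cosine_mean 0 q \<le> e / 4" and wp: "\<And>x. \<bar>w x - p x\<bar> \<le> q x"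
    and Wp: "\<forall>\<^sub>F r in at_top. \<forall>n. \<bar>W r n - p ((of_int n + c) / r)\<bar> \<le> q ((of_int n + c) / r)"
    using approx[of "e / 4"] by auto
  have cont: "continuous_on A f" if "real_polynomial_function f" for A and f :: "real \<Rightarrow> real"
    using that by (simp add: continuous_on_polymonial_function real_polynomial_function_eq)
  have wpi: "\<bar>cosine_mean \<nu> w - cosine_mean \<nu> p\<bar> \<le> e / 4"
    using cosine_mean_diff_le[OF w cont[OF p] cont[OF q] wp] qe by linarith
  let ?P = "\<lambda>r n. p ((of_int n + c) / r) * (bessel_Z n r * bessel_Z (n + \<nu>) r)"
  have "\<forall>\<^sub>F r in at_top. dist (infsum (?P r) UNIV) (cosine_mean \<nu> p) < e / 4"
    by (rule tendstoD[OF bessel_Z_polynomial_tendsto[OF p]]) (use e in simp)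
  moreover have "cosine_mean 0 q < e / 2"
    using qe e by linarith
  note order_tendstoD(2)[OF bessel_Z_majorant_tendsto[OF q, of c \<nu>] this]
  moreover note Wp eventually_gt_at_top[of 0]
  ultimately show "\<forall>\<^sub>F r in at_top.
      dist (\<Sum>\<^sub>\<infinity>n. W r n * (bessel_Z n r * bessel_Z (n + \<nu>) r)) (cosine_mean \<nu> w) < e"
  proof eventually_elim
    case (elim r)
    let ?D = "\<lambda>n. (W r n - p ((of_int n + c) / r)) * (bessel_Z n r * bessel_Z (n + \<nu>) r)"
    have "(\<lambda>n. ?D n + ?P r n) = (\<lambda>n. W r n * (bessel_Z n r * bessel_Z (n + \<nu>) r))"
      by (simp add: fun_eq_iff algebra_simps)
    moreover have "(\<Sum>\<^sub>\<infinity>n. ?D n + ?P r n) = infsum ?D UNIV + infsum (?P r) UNIV"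
      using elim by (intro infsum_add bessel_Z_majorant_summable[OF q] bessel_Z_polynomial_summable[OF p]) auto
    ultimately have eq: "(\<Sum>\<^sub>\<infinity>n. W r n * (bessel_Z n r * bessel_Z (n + \<nu>) r)) = infsum ?D UNIV + infsum (?P r) UNIV"
      by simp
    have "\<bar>infsum ?D UNIV\<bar> < e / 2"
      using bessel_Z_majorant_bound[OF q, of r "\<lambda>n. W r n - p ((of_int n + c) / r)" c \<nu>] elim by simp
    with eq elim(1) wpi show ?case
      unfolding dist_real_def by linarith
  qed
qed

subsection \<open>The limit integral\<close>

lemma pos_powr_cos_integrable:
  assumes "\<alpha> \<ge> 0"
  shows "(\<lambda>u. pos_powr \<alpha> (cos u) * cos (of_int \<nu> * u)) integrable_on {0..pi}"
proof (rule measurable_bounded_by_integrable_imp_integrable[where g = "\<lambda>_. 1"])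
  have "(\<lambda>u. pos_powr \<alpha> (cos u) * cos (of_int \<nu> * u)) \<in> borel_measurable borel"
    unfolding pos_powr_def by measurable
  then have "(\<lambda>u. pos_powr \<alpha> (cos u) * cos (of_int \<nu> * u)) \<in> borel_measurable lebesgue"
    by (intro measurable_completion) auto
  then show "(\<lambda>u. pos_powr \<alpha> (cos u) * cos (of_int \<nu> * u)) \<in> borel_measurable (lebesgue_on {0..pi})"
    by (rule measurable_restrict_space1)
  show "norm (pos_powr \<alpha> (cos u) * cos (of_int \<nu> * u)) \<le> 1" for u
    using assms by (auto simp: pos_powr_def abs_mult intro!: mult_le_one powr_le1)
qed auto

text \<open>Substitute t = (cos u)^2 in the Beta integral: the Jacobian 2 cos u sin u turns
  t^((\<alpha>-1)/2) (1-t)^(-1/2) into 2 (cos u)^\<alpha>. The other half of [0, pi] contributes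
  nothing, since there cos u \<le> 0.\<close>

lemma cosine_mean_pos_powr_0:
  assumes \<alpha>: "\<alpha> \<ge> 0"
  shows "cosine_mean 0 (pos_powr \<alpha>) = Beta ((\<alpha> + 1) / 2) (1 / 2) / (2 * pi)"
proof -
  let ?f = "\<lambda>t. t powr ((\<alpha> + 1) / 2 - 1) * (1 - t) powr (1 / 2 - 1)"
  let ?g = "\<lambda>u::real. (cos u)\<^sup>2" and ?g' = "\<lambda>u::real. - (2 * cos u * sin u)"
  let ?S = "{0<..<pi / 2}"
  have cs: "cos u > 0" "sin u > 0" if "u \<in> ?S" for u
    using that by (auto intro: cos_gt_zero sin_gt_zero)
  have img: "?g ` ?S = {0<..<1}"
  proof (intro equalityI subsetI)
    fix t assume "t \<in> ?g ` ?S"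
    then obtain u where u: "u \<in> ?S" "t = ?g u"
      by blast
    then have "0 < ?g u" "0 < (sin u)\<^sup>2"
      using cs[OF u(1)] by auto
    moreover from this have "?g u < 1"
      using sin_cos_squared_add[of u] by linarith
    ultimately show "t \<in> {0<..<1}"
      using u(2) by simp
  next
    fix t :: real assume t: "t \<in> {0<..<1}"
    then have st: "- 1 < sqrt t" "0 < sqrt t" "sqrt t < 1"
      by (auto intro: less_le_trans[of _ 0])
    then have "arccos (sqrt t) \<in> ?S"
      using arccos_lt_bounded[OF st(1,3)] arccos_less_arccos[of 0 "sqrt t"] by simp
    moreover have "cos (arccos (sqrt t)) = sqrt t"
      by (rule cos_arccos) (use st in linarith)+
    then have "t = ?g (arccos (sqrt t))"
      using t by simp
    ultimately show "t \<in> ?g ` ?S"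
      by blast
  qed
  have inj: "inj_on ?g ?S"
  proof (rule inj_onI)
    fix u v assume u: "u \<in> ?S" and v: "v \<in> ?S" and eq: "?g u = ?g v"
    have "cos u = cos v"
      using eq cs(1)[OF u] cs(1)[OF v] by (simp add: power2_eq_iff_nonneg)
    moreover have "0 \<le> u" "u \<le> pi" "0 \<le> v" "v \<le> pi"
      using u v by auto
    ultimately show "u = v"
      using cos_inj_pi by blast
  qed
  have "(?f has_integral Beta ((\<alpha> + 1) / 2) (1 / 2)) {0..1}"
    by (rule has_integral_Beta_real) (use \<alpha> in auto)
  \<comment> \<open>On the open interval sine and cosine are positive, so that the
    \<open>powr\<close> laws and cancellation by sin u are valid.\<close>
  then have B: "(?f has_integral Beta ((\<alpha> + 1) / 2) (1 / 2)) {0<..<1}"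
    by (simp only: has_integral_Icc_iff_Ioo)
  have "?f absolutely_integrable_on {0<..<1}"
    by (rule nonnegative_absolutely_integrable_1[OF has_integral_integrable[OF B]]) auto
  with integral_unique[OF B]
  have "?f absolutely_integrable_on ?g ` ?S \<and> integral (?g ` ?S) ?f = Beta ((\<alpha> + 1) / 2) (1 / 2)"
    unfolding img by blast
  moreover have "(?g has_field_derivative ?g' u) (at u within ?S)" for u
    by (auto intro!: derivative_eq_intros)
  ultimately have "(\<lambda>u. \<bar>?g' u\<bar> * ?f (?g u)) absolutely_integrable_on ?S \<and>
      integral ?S (\<lambda>u. \<bar>?g' u\<bar> * ?f (?g u)) = Beta ((\<alpha> + 1) / 2) (1 / 2)"
    using has_absolute_integral_change_of_variables_1'[OF _ _ inj, of ?g' ?f] by simp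
  then have "((\<lambda>u. \<bar>?g' u\<bar> * ?f (?g u)) has_integral Beta ((\<alpha> + 1) / 2) (1 / 2)) ?S"
    using set_lebesgue_integral_eq_integral(1) has_integral_iff by blast
  also have "?this \<longleftrightarrow> ((\<lambda>u. 2 * pos_powr \<alpha> (cos u)) has_integral Beta ((\<alpha> + 1) / 2) (1 / 2)) ?S"
  proof (rule has_integral_cong)
    fix u assume u: "u \<in> ?S"
    have sq: "(y\<^sup>2) powr a = y powr (2 * a)" if "y > 0" for y a :: real
      using that by (simp add: powr_powr flip: powr_numeral)
    have "1 - (cos u)\<^sup>2 = (sin u)\<^sup>2"
      by (simp add: sin_squared_eq)
    moreover have "2 * ((\<alpha> + 1) / 2 - 1) = \<alpha> - 1" "2 * (1 / 2 - 1) = (- 1 :: real)"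
      by (simp_all add: field_simps)
    ultimately have eq: "?f (?g u) = cos u powr (\<alpha> - 1) * sin u powr (- 1)"
      by (simp only: sq[OF cs(1)[OF u]] sq[OF cs(2)[OF u]])
    show "\<bar>?g' u\<bar> * ?f (?g u) = 2 * pos_powr \<alpha> (cos u)"
      unfolding eq using cs[OF u] by (simp add: abs_mult pos_powr_def powr_diff powr_minus field_simps)
  qed
  also have "\<dots> \<longleftrightarrow> ((\<lambda>u. 2 * pos_powr \<alpha> (cos u)) has_integral Beta ((\<alpha> + 1) / 2) (1 / 2)) {0..pi / 2}"
    by (rule has_integral_Icc_iff_Ioo[symmetric])
  also have "\<dots> \<longleftrightarrow> ((\<lambda>u. if u \<in> {0..pi / 2} then 2 * pos_powr \<alpha> (cos u) else 0)
      has_integral Beta ((\<alpha> + 1) / 2) (1 / 2)) {0..pi}"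
    by (subst has_integral_restrict) auto
  also have "\<dots> \<longleftrightarrow> ((\<lambda>u. 2 * pos_powr \<alpha> (cos u)) has_integral Beta ((\<alpha> + 1) / 2) (1 / 2)) {0..pi}"
  proof (rule has_integral_cong)
    fix u assume u: "u \<in> {0..pi}"
    have "cos u \<le> 0" if "u > pi / 2"
      using cos_monotone_0_pi_le[of "pi / 2" u] u that by simp
    with u show "(if u \<in> {0..pi / 2} then 2 * pos_powr \<alpha> (cos u) else 0) = 2 * pos_powr \<alpha> (cos u)"
      by (cases "u > pi / 2") (simp_all add: pos_powr_def)
  qed
  finally have "integral {0..pi} (\<lambda>u. 2 * pos_powr \<alpha> (cos u)) = Beta ((\<alpha> + 1) / 2) (1 / 2)"
    by (rule integral_unique)
  then show ?thesis
    by (simp add: cosine_mean_def field_simps)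
qed

section \<open>Gamma-function form of the limit\<close>

lemma Gamma_legendre_duplication_real:
  fixes x :: real
  assumes "x > 0"
  shows "Gamma x * Gamma (x + 1 / 2) = 2 powr (1 - 2 * x) * sqrt pi * Gamma (2 * x)"
proof -
  have "complex_of_real x \<notin> \<int>\<^sub>\<le>\<^sub>0" "complex_of_real (x + 1 / 2) \<notin> \<int>\<^sub>\<le>\<^sub>0"
    using assms by (auto simp only: of_real_in_nonpos_Ints_iff dest: nonpos_Ints_nonpos)
  then have "complex_of_real (Gamma x * Gamma (x + 1 / 2))
      = complex_of_real (exp ((1 - 2 * x) * ln 2) * sqrt pi * Gamma (2 * x))"
    using Gamma_legendre_duplication[of "complex_of_real x"]
    by (simp flip: Gamma_complex_of_real exp_of_real)
  then show ?thesis
    by (simp only: of_real_eq_iff powr_def) simp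
qed

text \<open>\<open>rGamma\<close> is the entire function 1/\<Gamma>, so the zeros at the poles of
  \<Gamma> are built in and the recurrence below holds without case distinction.\<close>

definition bessel_const :: "real \<Rightarrow> real \<Rightarrow> real" where
  "bessel_const \<nu> \<alpha> = 2 powr (- \<alpha> - 1) * Gamma (\<alpha> + 1)
     * rGamma ((- \<nu> + \<alpha> + 2) / 2) * rGamma ((\<nu> + \<alpha> + 2) / 2)"

lemma bessel_const_uminus: "bessel_const (- \<nu>) \<alpha> = bessel_const \<nu> \<alpha>"
  by (simp add: bessel_const_def)

text \<open>Counterpart of \<open>cosine_mean_recurrence\<close>, where multiplication by x raises
  \<alpha> by one. With rGamma(a) = a rGamma(a+1) both terms share a common factor; their
  coefficients add up to a + b = \<alpha> + 1, which turns \<Gamma>(\<alpha>+1) into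
  \<Gamma>(\<alpha>+2).\<close>

lemma bessel_const_recurrence:
  assumes "\<alpha> \<ge> 0"
  shows "bessel_const (\<nu> + 1) \<alpha> + bessel_const (\<nu> - 1) \<alpha> = 2 * bessel_const \<nu> (\<alpha> + 1)"
proof -
  define a where "a = (- \<nu> + \<alpha> + 1) / 2"
  define b where "b = (\<nu> + \<alpha> + 1) / 2"
  have args: "(- (\<nu> + 1) + \<alpha> + 2) / 2 = a" "((\<nu> + 1) + \<alpha> + 2) / 2 = b + 1"
    "(- (\<nu> - 1) + \<alpha> + 2) / 2 = a + 1" "((\<nu> - 1) + \<alpha> + 2) / 2 = b"
    "(- \<nu> + (\<alpha> + 1) + 2) / 2 = a + 1" "(\<nu> + (\<alpha> + 1) + 2) / 2 = b + 1"
    by (auto simp: a_def b_def field_simps)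
  have "rGamma a * rGamma (b + 1) + rGamma (a + 1) * rGamma b = (a + b) * (rGamma (a + 1) * rGamma (b + 1))"
    by (simp only: rGamma_plus1[of a, symmetric] rGamma_plus1[of b, symmetric]) (simp add: algebra_simps)
  also have "a + b = \<alpha> + 1"
    by (simp add: a_def b_def field_simps)
  finally have r: "rGamma a * rGamma (b + 1) + rGamma (a + 1) * rGamma b = (\<alpha> + 1) * (rGamma (a + 1) * rGamma (b + 1))" .
  have "\<alpha> + 1 \<notin> \<int>\<^sub>\<le>\<^sub>0"
    using assms by (auto dest: nonpos_Ints_nonpos)
  then have G: "Gamma (\<alpha> + 1 + 1) = (\<alpha> + 1) * Gamma (\<alpha> + 1)"
    by (rule Gamma_plus1)
  have p: "2 * 2 powr (- (\<alpha> + 1) - 1) = (2::real) powr (- \<alpha> - 1)"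
    by (simp add: powr_diff powr_minus powr_add field_simps)
  have "bessel_const (\<nu> + 1) \<alpha> + bessel_const (\<nu> - 1) \<alpha>
      = 2 powr (- \<alpha> - 1) * Gamma (\<alpha> + 1) * (rGamma a * rGamma (b + 1) + rGamma (a + 1) * rGamma b)"
    unfolding bessel_const_def args by (simp add: algebra_simps)
  also have "\<dots> = 2 * bessel_const \<nu> (\<alpha> + 1)"
    unfolding r bessel_const_def args G p[symmetric] by (simp add: mult_ac)
  finally show ?thesis .
qed

text \<open>Duplication at (\<alpha>+1)/2 splits \<Gamma>(\<alpha>+1); one factor cancels against
  the square of \<open>rGamma\<close>, and the leftover root of pi is \<Gamma>(1/2).\<close>

lemma bessel_const_0:
  assumes "\<alpha> \<ge> 0"
  shows "bessel_const 0 \<alpha> = Beta ((\<alpha> + 1) / 2) (1 / 2) / (2 * pi)"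
proof -
  have "Gamma ((\<alpha> + 1) / 2) * Gamma ((\<alpha> + 2) / 2) = 2 powr (- \<alpha>) * sqrt pi * Gamma (\<alpha> + 1)"
  proof -
    have eqs: "(\<alpha> + 1) / 2 + 1 / 2 = (\<alpha> + 2) / 2" "1 - (\<alpha> + 1) = - \<alpha>" "2 * ((\<alpha> + 1) / 2) = \<alpha> + 1"
      by (simp_all add: field_simps)
    have "(\<alpha> + 1) / 2 > 0"
      using assms by simp
    from Gamma_legendre_duplication_real[OF this] show ?thesis
      by (simp only: eqs)
  qed
  then have G: "2 powr (- \<alpha>) * Gamma (\<alpha> + 1) = Gamma ((\<alpha> + 1) / 2) * Gamma ((\<alpha> + 2) / 2) / sqrt pi"
    by (simp add: field_simps)
  have nz: "Gamma ((\<alpha> + 2) / 2) > 0"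
    using assms by (intro Gamma_real_pos) auto
  have "bessel_const 0 \<alpha> = (2 powr (- \<alpha>) * Gamma (\<alpha> + 1)) / 2 * (rGamma ((\<alpha> + 2) / 2))\<^sup>2"
    by (simp add: bessel_const_def powr_diff power2_eq_square)
  also have "\<dots> = Gamma ((\<alpha> + 1) / 2) / (2 * sqrt pi * Gamma ((\<alpha> + 2) / 2))"
    unfolding G using nz by (simp add: rGamma_inverse_Gamma power2_eq_square field_simps)
  also have "\<dots> = Gamma ((\<alpha> + 1) / 2) / Gamma ((\<alpha> + 2) / 2) / 2 * (1 / sqrt pi)"
    by simp
  also have "1 / sqrt pi = sqrt pi / pi"
    by (simp add: field_simps)
  also have "Gamma ((\<alpha> + 1) / 2) / Gamma ((\<alpha> + 2) / 2) / 2 * (sqrt pi / pi)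
      = Gamma ((\<alpha> + 1) / 2) * sqrt pi / Gamma ((\<alpha> + 2) / 2) / (2 * pi)"
    by simp
  also have "\<dots> = Beta ((\<alpha> + 1) / 2) (1 / 2) / (2 * pi)"
    by (simp add: Beta_def Gamma_one_half_real add_divide_distrib add.commute)
  finally show ?thesis .
qed

text \<open>Both sides satisfy the same recurrence, which gives order k + 2 at \<alpha> from order k
  at \<alpha> and order k + 1 at \<alpha> + 1. Hence \<alpha> varies in the induction.\<close>

lemma cosine_mean_pos_powr_nat:
  assumes "\<alpha> \<ge> 0"
  shows "cosine_mean (int k) (pos_powr \<alpha>) = bessel_const (real k) \<alpha>"
proof -
  have x: "(\<lambda>x. x * pos_powr a x) = pos_powr (a + 1)" for a
    by (auto simp: fun_eq_iff pos_powr_def powr_add)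
  have rec: "cosine_mean (n + 1) (pos_powr a) + cosine_mean (n - 1) (pos_powr a) = 2 * cosine_mean n (pos_powr (a + 1))"
    if "a \<ge> 0" for n a
    using cosine_mean_recurrence[OF pos_powr_cos_integrable pos_powr_cos_integrable, OF that that, of n]
    by (simp add: x)
  show ?thesis
    using assms
  proof (induction k arbitrary: \<alpha> rule: induct_nat_012)
    case 0
    then show ?case
      by (simp add: cosine_mean_pos_powr_0 bessel_const_0)
  next
    case 1
    \<comment> \<open>By this symmetry the recurrence at order 0 gives order 1 at \<alpha> from
      order 0 at \<alpha> + 1.\<close>
    have "cosine_mean (- 1) (pos_powr \<alpha>) = cosine_mean 1 (pos_powr \<alpha>)"
      by (simp add: cosine_mean_def)
    then show ?case
      using rec[OF 1, of 0] bessel_const_recurrence[OF 1, of 0] bessel_const_uminus[of 1 \<alpha>] 1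
      by (simp add: cosine_mean_pos_powr_0 bessel_const_0)
  next
    case (ge2 k)
    from ge2.IH(1)[OF ge2.prems] ge2.IH(2)[of "\<alpha> + 1"] ge2.prems
    show ?case
      using rec[OF ge2.prems, of "int (Suc k)"] bessel_const_recurrence[OF ge2.prems, of "real (Suc k)"]
      by (simp add: add.commute)
  qed
qed

lemma cosine_mean_pos_powr:
  assumes "\<alpha> \<ge> 0"
  shows "cosine_mean \<nu> (pos_powr \<alpha>) = bessel_const (of_int \<nu>) \<alpha>"
proof (cases \<nu> rule: int_cases2)
  case (nonpos k)
  have "cosine_mean (- int k) (pos_powr \<alpha>) = cosine_mean (int k) (pos_powr \<alpha>)"
    by (simp add: cosine_mean_def)
  with nonpos show ?thesis
    by (simp add: cosine_mean_pos_powr_nat[OF assms] bessel_const_uminus)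
qed (simp add: cosine_mean_pos_powr_nat[OF assms])

subsection \<open>The asymptotic formula\<close>

lemma smallo_powr_of_tendsto:
  fixes S :: "real \<Rightarrow> real"
  assumes "((\<lambda>r. S r) \<longlongrightarrow> L) at_top"
  shows "(\<lambda>r. r powr \<alpha> * S r - L * r powr \<alpha>) \<in> o[at_top](\<lambda>r. r powr \<alpha>)"
proof (rule smalloI_tendsto)
  have "((\<lambda>r. S r - L) \<longlongrightarrow> L - L) at_top"
    by (intro tendsto_intros assms)
  then have "((\<lambda>r. S r - L) \<longlongrightarrow> 0) at_top"
    by simp
  moreover have "\<forall>\<^sub>F r in at_top. S r - L = (r powr \<alpha> * S r - L * r powr \<alpha>) / r powr \<alpha>"
    using eventually_gt_at_top[of 0] by eventually_elim (simp add: field_simps)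
  ultimately show "((\<lambda>r. (r powr \<alpha> * S r - L * r powr \<alpha>) / r powr \<alpha>) \<longlongrightarrow> 0) at_top"
    by (rule Lim_transform_eventually)
  show "\<forall>\<^sub>F r in at_top. r powr \<alpha> \<noteq> 0"
    using eventually_gt_at_top[of 0] by eventually_elim simp
qed

theorem theorem1p3:
  fixes \<alpha> \<beta> \<nu> :: real and m m' :: nat
  assumes "\<alpha> \<ge> 0" and "\<beta> > -1"
    and "\<nu> = real m - real m'"
  shows "(\<forall>r>0. summable (\<lambda>i. let l = Suc i in
             Bessel_J (l + m') r * Bessel_J (l + m) r * (real l + \<beta>) powr \<alpha>)) \<and>
         (\<lambda>r. (\<Sum>i. let l = Suc i in
                   Bessel_J (l + m') r * Bessel_J (l + m) r * (real l + \<beta>) powr \<alpha>)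
               - 2 powr (- \<alpha> - 1) * Gamma (\<alpha> + 1)
                   * rGamma ((- \<nu> + \<alpha> + 2) / 2) * rGamma ((\<nu> + \<alpha> + 2) / 2)
                   * r powr \<alpha>)
           \<in> o[at_top](\<lambda>r. r powr \<alpha>)"
proof -
  \<comment> \<open>Under n = l + m' this shift gives n + c = l + \<beta>, and J_(l+m) has order n +
    \<open>\<mu>\<close>.\<close>
  define c where "c = \<beta> - real m'"
  define \<mu> where "\<mu> = int m - int m'"
  define W where "W r n = (if n > int m' then ((of_int n + c) / r) powr \<alpha> else 0)" for r and n :: int
  define G where "G r n = W r n * (bessel_Z n r * bessel_Z (n + \<mu>) r)" for r n
  let ?f = "\<lambda>r i. let l = Suc i in
    Bessel_J (l + m') r * Bessel_J (l + m) r * (real l + \<beta>) powr \<alpha>"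
  have pos_powr_01: "0 \<le> pos_powr \<alpha> x \<and> pos_powr \<alpha> x \<le> 1" if "\<bar>x\<bar> \<le> 1" for x
    using that \<open>\<alpha> \<ge> 0\<close> by (auto simp: pos_powr_def intro: powr_le1)
  have W_pos: "W r n = pos_powr \<alpha> ((of_int n + c) / r)" if "n > int m'" "r > 0" for r n
  proof -
    \<comment> \<open>Here l = n - m' \<ge> 1, so l + \<beta> > 0.\<close>
    have "of_int n + c > 0"
      using that \<open>\<beta> > -1\<close> by (simp add: c_def)
    with that show ?thesis
      by (simp add: W_def pos_powr_def)
  qed
  have G_summable: "G r summable_on UNIV" if r: "r > 0" for r
  proof -
    define K where "K = nat \<lceil>\<alpha>\<rceil>"
    have K: "real (2 * K) \<ge> \<alpha>"
      using \<open>\<alpha> \<ge> 0\<close> unfolding K_def by linarith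
    \<comment> \<open>A crude polynomial majorant: 1 covers [-1, 1], and the even power covers the
      rest.\<close>
    have "real_polynomial_function (\<lambda>x::real. 1 + x ^ (2 * K))"
      by (intro real_polynomial_function.intros real_polynomial_function_power bounded_linear_ident)
    moreover have "\<bar>pos_powr \<alpha> x\<bar> \<le> 1 + x ^ (2 * K)" for x
    proof (cases "\<bar>x\<bar> \<le> 1")
      case True
      have "x ^ (2 * K) \<ge> 0"
        by simp
      with pos_powr_01[OF True] show ?thesis
        by linarith
    next
      case False
      then have "pos_powr \<alpha> x \<le> \<bar>x\<bar> ^ (2 * K)"
        using K by (intro pos_powr_le_power) auto
      moreover have "pos_powr \<alpha> x \<ge> 0" "\<bar>x\<bar> ^ (2 * K) = x ^ (2 * K)"
        by (simp_all add: pos_powr_def power_even_abs)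
      ultimately show ?thesis
        by linarith
    qed
    then have "\<bar>W r n\<bar> \<le> 1 + ((of_int n + c) / r) ^ (2 * K)" for n
      using W_pos[OF _ r, of n] by (cases "n > int m'") (auto simp: W_def)
    ultimately show ?thesis
      unfolding G_def using r bessel_Z_majorant_summable by blast
  qed
  have f_sums: "?f r sums (r powr \<alpha> * infsum (G r) UNIV)" if r: "r > 0" for r
  proof -
    have "(G r has_sum infsum (G r) UNIV) UNIV"
      using G_summable[OF r] by simp
    also have "?this \<longleftrightarrow> (G r has_sum infsum (G r) UNIV) {n. n > int m'}"
      by (rule has_sum_cong_neutral) (auto simp: G_def W_def)
    \<comment> \<open>The index i stands for l = i + 1, hence n = i + 1 + m'.\<close>
    also have "\<dots> \<longleftrightarrow> ((\<lambda>i. G r (int (Suc i + m'))) has_sum infsum (G r) UNIV) UNIV"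
      by (rule has_sum_reindex_bij_witness[symmetric, where j = "\<lambda>i. int (Suc i + m')"
            and i = "\<lambda>n. nat (n - int m' - 1)"]) auto
    finally have "(\<lambda>i. G r (int (Suc i + m'))) sums infsum (G r) UNIV"
      by (rule has_sum_imp_sums)
    then have "(\<lambda>i. r powr \<alpha> * G r (int (Suc i + m'))) sums (r powr \<alpha> * infsum (G r) UNIV)"
      by (rule sums_mult)
    moreover have "r powr \<alpha> * G r (int (Suc i + m')) = ?f r i" for i
    proof -
      have "r powr \<alpha> * G r (int (Suc i + m')) = bessel_Z (int (Suc i + m')) r
          * bessel_Z (int (Suc i + m') + \<mu>) r * (r powr \<alpha> * W r (int (Suc i + m')))"
        by (simp only: G_def mult_ac)
      also have "int (Suc i + m') + \<mu> = int (Suc i + m)"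
        by (simp add: \<mu>_def)
      also have "r powr \<alpha> * W r (int (Suc i + m')) = (real (Suc i) + \<beta>) powr \<alpha>"
        using r \<open>\<beta> > -1\<close> by (simp add: W_def c_def powr_divide add.assoc)
      finally show ?thesis
        by (simp add: bessel_Z_def Let_def del: of_nat_add of_nat_Suc)
    qed
    ultimately show ?thesis
      by (simp only:)
  qed
  have "((\<lambda>r. infsum (G r) UNIV) \<longlongrightarrow> cosine_mean \<mu> (pos_powr \<alpha>)) at_top"
    unfolding G_def
  proof (rule bessel_Z_weighted_tendsto[OF pos_powr_cos_integrable[OF \<open>\<alpha> \<ge> 0\<close>], where c = c])
    fix \<epsilon> :: real assume "\<epsilon> > 0"
    then obtain p q \<delta> where pq: "real_polynomial_function p" "real_polynomial_function q"
      and \<delta>: "0 < \<delta>" "\<delta> \<le> 1" and qe: "cosine_mean 0 q \<le> \<epsilon>"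
      and approx: "\<And>x w. (\<bar>x\<bar> \<ge> \<delta> \<Longrightarrow> w = pos_powr \<alpha> x) \<Longrightarrow> (\<bar>x\<bar> < \<delta> \<Longrightarrow> 0 \<le> w \<and> w \<le> 1)
        \<Longrightarrow> \<bar>w - p x\<bar> \<le> q x"
      using pos_powr_polynomial_approx[OF \<open>\<alpha> \<ge> 0\<close>] by metis
    have w: "\<bar>pos_powr \<alpha> x - p x\<bar> \<le> q x" for x
      using pos_powr_01[of x] \<delta> by (intro approx) auto
    have "\<forall>\<^sub>F r in at_top. \<forall>n. \<bar>W r n - p ((of_int n + c) / r)\<bar> \<le> q ((of_int n + c) / r)"
      \<comment> \<open>The cut at n = m' need not be where n + c changes sign. For n \<le> m' the
        weight is 0 and n + c \<le> \<beta>; once \<beta> < \<delta> r, such a node lies either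
        within \<delta> of 0, where any value in [0, 1] is allowed, or at most at -\<delta>, where
        \<open>pos_powr \<alpha>\<close> vanishes.\<close>
      using eventually_gt_at_top[of 0] eventually_gt_at_top[of "\<beta> / \<delta>"]
    proof eventually_elim
      case (elim r)
      show ?case
      proof
        fix n
        show "\<bar>W r n - p ((of_int n + c) / r)\<bar> \<le> q ((of_int n + c) / r)"
        proof (cases "n > int m'")
          case True
          with w elim show ?thesis
            by (simp add: W_pos)
        next
          case False
          then have "real_of_int n \<le> real m'"
            by linarith
          then have "of_int n + c \<le> \<beta>"
            by (simp add: c_def)
          also have "\<beta> < \<delta> * r"
            using elim \<delta> by (simp add: field_simps)
          finally have "(of_int n + c) / r < \<delta>"
            using elim by (simp add: field_simps)
          with False \<delta> show ?thesis
            by (intro approx) (auto simp: W_def pos_powr_def)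
        qed
      qed
    qed
    with pq qe w show "\<exists>p q. real_polynomial_function p \<and> real_polynomial_function q \<and>
        cosine_mean 0 q \<le> \<epsilon> \<and> (\<forall>x. \<bar>pos_powr \<alpha> x - p x\<bar> \<le> q x) \<and>
        (\<forall>\<^sub>F r in at_top. \<forall>n. \<bar>W r n - p ((of_int n + c) / r)\<bar> \<le> q ((of_int n + c) / r))"
      by blast
  qed
  also have "cosine_mean \<mu> (pos_powr \<alpha>) = bessel_const \<nu> \<alpha>"
    using cosine_mean_pos_powr[OF \<open>\<alpha> \<ge> 0\<close>, of \<mu>] assms(3) by (simp add: \<mu>_def)
  finally have "(\<lambda>r. r powr \<alpha> * infsum (G r) UNIV - bessel_const \<nu> \<alpha> * r powr \<alpha>) \<in> o[at_top](\<lambda>r. r powr \<alpha>)"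
    by (rule smallo_powr_of_tendsto)
  also have "?this \<longleftrightarrow> (\<lambda>r. suminf (?f r) - bessel_const \<nu> \<alpha> * r powr \<alpha>) \<in> o[at_top](\<lambda>r. r powr \<alpha>)"
  proof (rule landau_o.small.in_cong)
    show "\<forall>\<^sub>F r in at_top. r powr \<alpha> * infsum (G r) UNIV - bessel_const \<nu> \<alpha> * r powr \<alpha>
        = suminf (?f r) - bessel_const \<nu> \<alpha> * r powr \<alpha>"
      using eventually_gt_at_top[of 0] by eventually_elim (simp add: sums_unique[OF f_sums])
  qed
  finally show ?thesis
    using f_sums sums_summable unfolding bessel_const_def by blast
qed

end
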